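(* Let $(\mathcal{C},\otimes,\alpha)$ be a skew semimonoidal category, and let $(I,\lambda,\rho)$ and $(J,\lambda',\rho')$ be objects of its category of units $\mathcal{U}(\mathcal{C})$. Then there is exactly one morphism from $(I,\lambda,\rho)$ to $(J,\lambda',\rho')$ in $\mathcal{U}(\mathcal{C})$.
   Context: A skew semimonoidal category $(\mathcal{C},\otimes,\alpha)$ is a category $\mathcal{C}$ with a functor $\otimes:\mathcal{C}\times\mathcal{C}\to\mathcal{C}$ and a natural transformation (not assumed invertible) with components $\alpha_{X,Y,Z}:(X\otimes Y)\otimes Z\to X\otimes(Y\otimes Z)$ such that for all $W,X,Y,Z$ $$\alpha_{W,X,Y\otimes Z}\circ\alpha_{W\otimes X,Y,Z}=(1_W\otimes\alpha_{X,Y,Z})\circ\alpha_{W,X\otimes Y,Z}\circ(\alpha_{W,X,Y}\otimes 1_Z).$$ The category of units $\mathcal{U}(\mathcal{C})$ has as objects the triples $(I,\lambda,\rho)$ where $I$ is an object of $\mathcal{C}$ and $\lambda_X:I\otimes X\to X$, $\rho_X:X\to X\otimes I$ are natural families of morphisms (not assumed invertible) such that for all $X,Y$: - $\lambda_{X\otimes Y}\circ\alpha_{I,X,Y}=\lambda_X\otimes 1_Y$; - $(1_X\otimes\lambda_Y)\circ\alpha_{X,I,Y}\circ(\rho_X\otimes 1_Y)=1_{X\otimes Y}$; - $\alpha_{X,Y,I}\circ\rho_{X\otimes Y}=1_X\otimes\rho_Y$; - $\lambda_I\circ\rho_I=1_I$. A morphism $(I,\lambda,\rho)\to(J,\lambda',\rho')$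 in $\mathcal{U}(\mathcal{C})$ is a morphism $\varphi:I\to J$ of $\mathcal{C}$ such that for all $X$: $\lambda'_X\circ(\varphi\otimes 1_X)=\lambda_X$ and $(1_X\otimes\varphi)\circ\rho_X=\rho'_X$. Composition is that of $\mathcal{C}$. *)

theory Defs
  imports "HOL-Library.FuncSet"
begin

section \<open>Categories, functors, natural transformations\<close>

record ('o, 'm) cat =
  Obj :: "'o set"
  Arr :: "'m set"
  Dom :: "'m \<Rightarrow> 'o"
  Cod :: "'m \<Rightarrow> 'o"
  Id :: "'o \<Rightarrow> 'm"
  Comp :: "'m \<Rightarrow> 'm \<Rightarrow> 'm"  (infixl \<open>\<cdot>\<index>\<close> 65)

definition Hom :: "('o, 'm, 'z) cat_scheme \<Rightarrow> 'o \<Rightarrow> 'o \<Rightarrow> 'm set"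
  where "Hom C X Y = {f \<in> Arr C. Dom C f = X \<and> Cod C f = Y}"

text \<open>The composite \<open>g \<cdot>\<^bsub>C\<^esub> f\<close> is \<open>g\<close> after \<open>f\<close>.  The values of
  the operations outside \<open>Obj C\<close> and \<open>Arr C\<close> (or on non-composable pairs) are irrelevant.\<close>

locale category =
  fixes C :: "('o, 'm, 'z) cat_scheme" (structure)
  assumes dom_obj: "f \<in> Arr C \<Longrightarrow> Dom C f \<in> Obj C"
    and cod_obj: "f \<in> Arr C \<Longrightarrow> Cod C f \<in> Obj C"
    and id_hom: "X \<in> Obj C \<Longrightarrow> Id C X \<in> Hom C X X"
    and comp_hom: "\<lbrakk>f \<in> Hom C X Y; g \<in> Hom C Y Z\<rbrakk> \<Longrightarrow> g \<cdot> f \<in> Hom C X Z"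
    and id_left: "f \<in> Hom C X Y \<Longrightarrow> Id C Y \<cdot> f = f"
    and id_right: "f \<in> Hom C X Y \<Longrightarrow> f \<cdot> Id C X = f"
    and comp_assoc: "\<lbrakk>f \<in> Hom C W X; g \<in> Hom C X Y; h \<in> Hom C Y Z\<rbrakk>
      \<Longrightarrow> (h \<cdot> g) \<cdot> f = h \<cdot> (g \<cdot> f)"

definition prod_cat ::
  "('o, 'm, 'z) cat_scheme \<Rightarrow> ('p, 'n, 'w) cat_scheme \<Rightarrow> ('o \<times> 'p, 'm \<times> 'n) cat"
  where "prod_cat A B =
    \<lparr>Obj = Obj A \<times> Obj B,
     Arr = Arr A \<times> Arr B,
     Dom = (\<lambda>(f, g). (Dom A f, Dom B g)),
     Cod = (\<lambda>(f, g). (Cod A f, Cod B g)),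
     Id = (\<lambda>(X, Y). (Id A X, Id B Y)),
     Comp = (\<lambda>(f', g') (f, g). (f' \<cdot>\<^bsub>A\<^esub> f, g' \<cdot>\<^bsub>B\<^esub> g))\<rparr>"

locale cat_functor = A: category A + B: category B
  for A :: "('o, 'm, 'z) cat_scheme" and B :: "('p, 'n, 'w) cat_scheme" +
  fixes Fo :: "'o \<Rightarrow> 'p" and Fa :: "'m \<Rightarrow> 'n"
  assumes obj: "X \<in> Obj A \<Longrightarrow> Fo X \<in> Obj B"
    and hom: "f \<in> Hom A X Y \<Longrightarrow> Fa f \<in> Hom B (Fo X) (Fo Y)"
    and ident: "X \<in> Obj A \<Longrightarrow> Fa (Id A X) = Id B (Fo X)"
    and comp: "\<lbrakk>f \<in> Hom A X Y; g \<in> Hom A Y Z\<rbrakk> \<Longrightarrow> Fa (g \<cdot>\<^bsub>A\<^esub> f) = Fa g \<cdot>\<^bsub>B\<^esub> Fa f"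

locale nat_trans = F: cat_functor A B Fo Fa + G: cat_functor A B Go Ga
  for A :: "('o, 'm, 'z) cat_scheme" and B :: "('p, 'n, 'w) cat_scheme"
    and Fo :: "'o \<Rightarrow> 'p" and Fa :: "'m \<Rightarrow> 'n" and Go :: "'o \<Rightarrow> 'p" and Ga :: "'m \<Rightarrow> 'n" +
  fixes \<tau> :: "'o \<Rightarrow> 'n"
  assumes component: "X \<in> Obj A \<Longrightarrow> \<tau> X \<in> Hom B (Fo X) (Go X)"
    and natural: "f \<in> Hom A X Y \<Longrightarrow> \<tau> Y \<cdot>\<^bsub>B\<^esub> Fa f = Ga f \<cdot>\<^bsub>B\<^esub> \<tau> X"


section \<open>Skew semimonoidal categories\<close>

text \<open>The tensor product is written \<open>\<odot>\<close> on objects and \<open>\<otimes>\<close> on morphisms.\<close>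

record ('o, 'm) skew_cat = "('o, 'm) cat" +
  TObj :: "'o \<Rightarrow> 'o \<Rightarrow> 'o"  (infixl \<open>\<odot>\<index>\<close> 70)
  TArr :: "'m \<Rightarrow> 'm \<Rightarrow> 'm"  (infixl \<open>\<otimes>\<index>\<close> 70)
  Assoc :: "'o \<Rightarrow> 'o \<Rightarrow> 'o \<Rightarrow> 'm"  (\<open>\<alpha>\<index>\<close>)

locale skew_semimonoidal_category = category C
  for C :: "('o, 'm, 'z) skew_cat_scheme" (structure) +
  assumes tensor_functor:
      "cat_functor (prod_cat C C) C (\<lambda>(X, Y). X \<odot> Y) (\<lambda>(f, g). f \<otimes> g)"
    and assoc_natural:
      "nat_trans (prod_cat (prod_cat C C) C) C
        (\<lambda>((X, Y), Z). (X \<odot> Y) \<odot> Z) (\<lambda>((f, g), h). (f \<otimes> g) \<otimes> h)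
        (\<lambda>((X, Y), Z). X \<odot> (Y \<odot> Z)) (\<lambda>((f, g), h). f \<otimes> (g \<otimes> h))
        (\<lambda>((X, Y), Z). \<alpha> X Y Z)"
    and pentagon:
      "\<lbrakk>W \<in> Obj C; X \<in> Obj C; Y \<in> Obj C; Z \<in> Obj C\<rbrakk> \<Longrightarrow>
        \<alpha> W X (Y \<odot> Z) \<cdot> \<alpha> (W \<odot> X) Y Z =
        (Id C W \<otimes> \<alpha> X Y Z) \<cdot> \<alpha> W (X \<odot> Y) Z \<cdot> (\<alpha> W X Y \<otimes> Id C Z)"


section \<open>The category of units\<close>

text \<open>The families \<open>l\<close> (the left unit map, \<open>\<lambda>\<close> in the literature) and \<open>r\<close> (the right unit map
  \<open>\<rho>\<close>) are indexed by \<open>Obj C\<close>.  As HOL functions they are required to be \<open>extensional\<close>, so that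
  two units are equal precisely when their objects and all components agree.\<close>

locale skew_unit = skew_semimonoidal_category C
  for C :: "('o, 'm, 'z) skew_cat_scheme" (structure) +
  fixes I :: 'o and l :: "'o \<Rightarrow> 'm" and r :: "'o \<Rightarrow> 'm"
  assumes unit_obj: "I \<in> Obj C"
    and l_extensional: "l \<in> extensional (Obj C)"
    and r_extensional: "r \<in> extensional (Obj C)"
    and l_natural: "nat_trans C C (\<lambda>X. I \<odot> X) (\<lambda>f. Id C I \<otimes> f) (\<lambda>X. X) (\<lambda>f. f) l"
    and r_natural: "nat_trans C C (\<lambda>X. X) (\<lambda>f. f) (\<lambda>X. X \<odot> I) (\<lambda>f. f \<otimes> Id C I) r"
    and l_tensor: "\<lbrakk>X \<in> Obj C; Y \<in> Obj C\<rbrakk> \<Longrightarrow> l (X \<odot> Y) \<cdot> \<alpha> I X Y = l X \<otimes> Id C Y"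
    and triangle: "\<lbrakk>X \<in> Obj C; Y \<in> Obj C\<rbrakk> \<Longrightarrow>
      (Id C X \<otimes> l Y) \<cdot> \<alpha> X I Y \<cdot> (r X \<otimes> Id C Y) = Id C (X \<odot> Y)"
    and r_tensor: "\<lbrakk>X \<in> Obj C; Y \<in> Obj C\<rbrakk> \<Longrightarrow> \<alpha> X Y I \<cdot> r (X \<odot> Y) = Id C X \<otimes> r Y"
    and l_r_unit: "l I \<cdot> r I = Id C I"

locale skew_unit_morphism = U: skew_unit C I l r + V: skew_unit C J l' r'
  for C :: "('o, 'm, 'z) skew_cat_scheme" (structure)
    and I :: 'o and l :: "'o \<Rightarrow> 'm" and r :: "'o \<Rightarrow> 'm"
    and J :: 'o and l' :: "'o \<Rightarrow> 'm" and r' :: "'o \<Rightarrow> 'm" +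
  fixes \<phi> :: 'm
  assumes mor_hom: "\<phi> \<in> Hom C I J"
    and mor_l: "X \<in> Obj C \<Longrightarrow> l' X \<cdot> (\<phi> \<otimes> Id C X) = l X"
    and mor_r: "X \<in> Obj C \<Longrightarrow> (Id C X \<otimes> \<phi>) \<cdot> r X = r' X"

type_synonym ('o, 'm) unit_triple = "'o \<times> ('o \<Rightarrow> 'm) \<times> ('o \<Rightarrow> 'm)"

text \<open>The same morphism \<open>\<phi>\<close> of \<open>C\<close> may be a morphism between several pairs of units, so an
  arrow of the category of units records its source and target along with \<open>\<phi>\<close>.\<close>

definition units_cat :: "('o, 'm, 'z) skew_cat_scheme \<Rightarrow>
    (('o, 'm) unit_triple, ('o, 'm) unit_triple \<times> 'm \<times> ('o, 'm) unit_triple) cat"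
  where "units_cat C =
    \<lparr>Obj = {(I, l, r). skew_unit C I l r},
     Arr = {((I, l, r), \<phi>, (J, l', r')) | I l r \<phi> J l' r'.
       skew_unit_morphism C I l r J l' r' \<phi>},
     Dom = (\<lambda>(U, \<phi>, V). U),
     Cod = (\<lambda>(U, \<phi>, V). V),
     Id = (\<lambda>U. (U, Id C (fst U), U)),
     Comp = (\<lambda>(V, \<psi>, W) (U, \<phi>, V'). (U, \<psi> \<cdot>\<^bsub>C\<^esub> \<phi>, W))\<rparr>"

lemma prod_cat_Hom: "Hom (prod_cat A B) (X, Y) (X', Y') = Hom A X X' \<times> Hom B Y Y'"
  by (auto simp: Hom_def prod_cat_def)

lemma units_cat_Hom: "f \<in> Hom (units_cat C) (I, l, r) (J, l', r') \<longleftrightarrow>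
    (\<exists>\<phi>. f = ((I, l, r), \<phi>, (J, l', r')) \<and> skew_unit_morphism C I l r J l' r' \<phi>)"
  by (auto simp: Hom_def units_cat_def)

context skew_semimonoidal_category
begin

lemma tensor_hom:
  "\<lbrakk>f \<in> Hom C X X'; g \<in> Hom C Y Y'\<rbrakk> \<Longrightarrow> f \<otimes> g \<in> Hom C (X \<odot> Y) (X' \<odot> Y')"
  using cat_functor.hom[OF tensor_functor, of "(f, g)" "(X, Y)" "(X', Y')"]
  by (simp add: prod_cat_Hom)

lemma tensor_id: "\<lbrakk>X \<in> Obj C; Y \<in> Obj C\<rbrakk> \<Longrightarrow> Id C X \<otimes> Id C Y = Id C (X \<odot> Y)"
  using cat_functor.ident[OF tensor_functor, of "(X, Y)"] by (simp add: prod_cat_def)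

lemma tensor_comp:
  assumes "f \<in> Hom C X X'" "f' \<in> Hom C X' X''" "g \<in> Hom C Y Y'" "g' \<in> Hom C Y' Y''"
  shows "(f' \<cdot> f) \<otimes> (g' \<cdot> g) = (f' \<otimes> g') \<cdot> (f \<otimes> g)"
  using cat_functor.comp[OF tensor_functor,
      of "(f, g)" "(X, Y)" "(X', Y')" "(f', g')" "(X'', Y'')"] assms
  by (simp add: prod_cat_Hom) (simp add: prod_cat_def)

lemma unit_id_morphism:
  assumes "skew_unit C I l r"
  shows "skew_unit_morphism C I l r I l r (Id C I)"
proof -
  interpret U: skew_unit C I l r by fact
  have l: "l X \<in> Hom C (I \<odot> X) X" and r: "r X \<in> Hom C X (X \<odot> I)" if "X \<in> Obj C" for X
    using nat_trans.component[OF U.l_natural that] nat_trans.component[OF U.r_natural that]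
    by auto
  show ?thesis
    by unfold_locales
      (use l r id_hom U.unit_obj in \<open>auto simp: tensor_id intro: id_right id_left\<close>)
qed

lemma unit_comp_morphism:
  assumes "skew_unit_morphism C I l r J l' r' \<phi>" "skew_unit_morphism C J l' r' K l'' r'' \<psi>"
  shows "skew_unit_morphism C I l r K l'' r'' (\<psi> \<cdot> \<phi>)"
proof -
  interpret F: skew_unit_morphism C I l r J l' r' \<phi> by fact
  interpret G: skew_unit_morphism C J l' r' K l'' r'' \<psi> by fact
  show ?thesis
  proof unfold_locales
    show "\<psi> \<cdot> \<phi> \<in> Hom C I K" using F.mor_hom G.mor_hom by (rule comp_hom)
  next
    fix X assume X: "X \<in> Obj C"
    note i = id_hom[OF X]
    have ii: "Id C X \<cdot> Id C X = Id C X" using i by (rule id_left)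
    have l: "l'' X \<in> Hom C (K \<odot> X) X"
      using nat_trans.component[OF G.V.l_natural X] by simp
    have r: "r X \<in> Hom C X (X \<odot> I)"
      using nat_trans.component[OF F.U.r_natural X] by simp
    have "(\<psi> \<cdot> \<phi>) \<otimes> Id C X = (\<psi> \<otimes> Id C X) \<cdot> (\<phi> \<otimes> Id C X)"
      using tensor_comp[OF F.mor_hom G.mor_hom i i] by (simp add: ii)
    then show "l'' X \<cdot> ((\<psi> \<cdot> \<phi>) \<otimes> Id C X) = l X"
      using comp_assoc[OF tensor_hom[OF F.mor_hom i] tensor_hom[OF G.mor_hom i] l]
        F.mor_l[OF X] G.mor_l[OF X] by simp
    have "Id C X \<otimes> (\<psi> \<cdot> \<phi>) = (Id C X \<otimes> \<psi>) \<cdot> (Id C X \<otimes> \<phi>)"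
      using tensor_comp[OF i i F.mor_hom G.mor_hom] by (simp add: ii)
    then show "(Id C X \<otimes> (\<psi> \<cdot> \<phi>)) \<cdot> r X = r'' X"
      using comp_assoc[OF r tensor_hom[OF i F.mor_hom] tensor_hom[OF i G.mor_hom]]
        F.mor_r[OF X] G.mor_r[OF X] by simp
  qed
qed

lemma units_cat_category: "category (units_cat C)"
proof
  fix f assume "f \<in> Arr (units_cat C)"
  then show "Dom (units_cat C) f \<in> Obj (units_cat C)" "Cod (units_cat C) f \<in> Obj (units_cat C)"
    by (auto simp: units_cat_def skew_unit_morphism_def)
next
  fix X assume "X \<in> Obj (units_cat C)"
  then show "Id (units_cat C) X \<in> Hom (units_cat C) X X"
    by (cases X) (auto simp: units_cat_def Hom_def intro: unit_id_morphism)
next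
  fix f g X Y Z
  assume "f \<in> Hom (units_cat C) X Y" "g \<in> Hom (units_cat C) Y Z"
  then show "g \<cdot>\<^bsub>units_cat C\<^esub> f \<in> Hom (units_cat C) X Z"
    by (auto simp: units_cat_def Hom_def intro: unit_comp_morphism)
next
  fix f X Y
  assume "f \<in> Hom (units_cat C) X Y"
  then show "Id (units_cat C) Y \<cdot>\<^bsub>units_cat C\<^esub> f = f" "f \<cdot>\<^bsub>units_cat C\<^esub> Id (units_cat C) X = f"
    by (auto simp: units_cat_def Hom_def
        intro: id_left id_right dest!: skew_unit_morphism.mor_hom)
next
  fix f g h W X Y Z
  assume "f \<in> Hom (units_cat C) W X" "g \<in> Hom (units_cat C) X Y" "h \<in> Hom (units_cat C) Y Z"
  then show "(h \<cdot>\<^bsub>units_cat C\<^esub> g) \<cdot>\<^bsub>units_cat C\<^esub> f =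
      h \<cdot>\<^bsub>units_cat C\<^esub> (g \<cdot>\<^bsub>units_cat C\<^esub> f)"
    by (auto simp: units_cat_def Hom_def
        intro: comp_assoc dest!: skew_unit_morphism.mor_hom)
qed

end

end

theory Submission
  imports Defs
begin

text \<open>
  Between two units \<open>(I, \<lambda>, \<rho>)\<close> and \<open>(J, \<lambda>', \<rho>')\<close> there is a canonical arrow obtained by inserting
  \<open>J\<close> on the right of \<open>I\<close> with the right unit map of \<open>J\<close>, and then removing \<open>I\<close> on the left with
  the left unit map of \<open>I\<close>:
  \<open>\<phi> = \<lambda>\<^sub>J \<cdot> \<rho>'\<^sub>I : I \<rightarrow> I \<odot> J \<rightarrow> J\<close>.

  Uniqueness (\<open>skew_unit_morphism.mor_eq\<close>): the unit law \<open>\<lambda>\<^sub>I \<cdot> \<rho>\<^sub>I = 1\<close> lets any morphism \<open>\<phi>\<close> of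
  units be written as \<open>\<phi> \<cdot> \<lambda>\<^sub>I \<cdot> \<rho>\<^sub>I\<close>; pulling \<open>\<phi>\<close> through \<open>\<lambda>\<close> turns this into
  \<open>\<lambda>\<^sub>J \<cdot> (1 \<otimes> \<phi>) \<cdot> \<rho>\<^sub>I\<close>, and compatibility of \<open>\<phi>\<close> with the right unit maps leaves
  \<open>\<lambda>\<^sub>J \<cdot> \<rho>'\<^sub>I\<close>.

  Existence (\<open>canonical_unit_morphism\<close>): each compatibility condition for the canonical arrow
  reduces to one instance of the triangle law.  For the left unit maps,
  \<open>\<lambda>\<^sub>J \<otimes> 1 = \<lambda> \<cdot> \<alpha>\<close> and naturality of \<open>\<lambda>\<close> expose the triangle of \<open>J\<close> at \<open>(I, X)\<close>;
  for the right unit maps, \<open>1 \<otimes> \<rho>'\<^sub>I = \<alpha> \<cdot> \<rho>'\<close> and naturality of \<open>\<rho>'\<close> expose the triangle of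
  \<open>I\<close> at \<open>(X, J)\<close>.
\<close>

lemma (in skew_semimonoidal_category) assoc_hom:
  assumes "X \<in> Obj C" "Y \<in> Obj C" "Z \<in> Obj C"
  shows "\<alpha> X Y Z \<in> Hom C ((X \<odot> Y) \<odot> Z) (X \<odot> (Y \<odot> Z))"
  using nat_trans.component[OF assoc_natural, of "((X, Y), Z)"] assms
  by (simp add: prod_cat_def)

lemma (in skew_semimonoidal_category) tensor_obj:
  "\<lbrakk>X \<in> Obj C; Y \<in> Obj C\<rbrakk> \<Longrightarrow> X \<odot> Y \<in> Obj C"
  using cat_functor.obj[OF tensor_functor, of "(X, Y)"] by (simp add: prod_cat_def)

context skew_unit
begin

lemma l_hom: "X \<in> Obj C \<Longrightarrow> l X \<in> Hom C (I \<odot> X) X"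
  using nat_trans.component[OF l_natural] by simp

lemma r_hom: "X \<in> Obj C \<Longrightarrow> r X \<in> Hom C X (X \<odot> I)"
  using nat_trans.component[OF r_natural] by simp

lemma l_nat: "f \<in> Hom C X Y \<Longrightarrow> l Y \<cdot> (Id C I \<otimes> f) = f \<cdot> l X"
  using nat_trans.natural[OF l_natural] by simp

lemma r_nat: "f \<in> Hom C X Y \<Longrightarrow> r Y \<cdot> f = (f \<otimes> Id C I) \<cdot> r X"
  using nat_trans.natural[OF r_natural] by simp

end

text \<open>Since the right-hand side does not mention \<open>\<phi>\<close>, two parallel morphisms of units coincide.\<close>

lemma (in skew_unit_morphism) mor_eq: "\<phi> = l J \<cdot> r' I"
proof -
  note I = U.unit_obj and J = V.unit_obj
  note i = U.id_hom[OF I]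
  have "\<phi> = \<phi> \<cdot> (l I \<cdot> r I)"
    using U.id_right[OF mor_hom] by (simp add: U.l_r_unit)
  also have "\<dots> = (\<phi> \<cdot> l I) \<cdot> r I"
    using U.comp_assoc[OF U.r_hom[OF I] U.l_hom[OF I] mor_hom] by simp
  also have "\<dots> = (l J \<cdot> (Id C I \<otimes> \<phi>)) \<cdot> r I"
    using U.l_nat[OF mor_hom] by simp
  also have "\<dots> = l J \<cdot> ((Id C I \<otimes> \<phi>) \<cdot> r I)"
    by (rule U.comp_assoc[OF U.r_hom[OF I] U.tensor_hom[OF i mor_hom] U.l_hom[OF J]])
  also have "\<dots> = l J \<cdot> r' I"
    by (simp add: mor_r[OF I])
  finally show ?thesis .
qed

text \<open>The composites below are first bracketed so that the triangle law of one of the two units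
  becomes visible, and then collapse because the triangle composite is an identity.\<close>

lemma canonical_unit_morphism:
  assumes "skew_unit C I l r" and "skew_unit C J l' r'"
  shows "skew_unit_morphism C I l r J l' r' (l J \<cdot>\<^bsub>C\<^esub> r' I)"
proof -
  interpret U: skew_unit C I l r by fact
  interpret V: skew_unit C J l' r' by fact
  note I = U.unit_obj and J = V.unit_obj
  note rI = V.r_hom[OF I] and lJ = U.l_hom[OF J]
  show ?thesis
  proof unfold_locales
    show "l J \<cdot>\<^bsub>C\<^esub> r' I \<in> Hom C I J" using rI lJ by (rule U.comp_hom)
  next
    fix X assume X: "X \<in> Obj C"
    note x = U.id_hom[OF X] and i = U.id_hom[OF I] and j = U.id_hom[OF J]
    have xx: "Id C X \<cdot>\<^bsub>C\<^esub> Id C X = Id C X" using x by (rule U.id_left)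

    show "l' X \<cdot>\<^bsub>C\<^esub> ((l J \<cdot>\<^bsub>C\<^esub> r' I) \<otimes>\<^bsub>C\<^esub> Id C X) = l X"
    proof -
      note JX = U.tensor_obj[OF J X]
      note a = U.assoc_hom[OF I J X] and ljx = U.l_hom[OF JX] and l'x = V.l_hom[OF X]
      note rx = U.tensor_hom[OF rI x] and lx = U.tensor_hom[OF lJ x]
      note il' = U.tensor_hom[OF i l'x]
      have "l' X \<cdot>\<^bsub>C\<^esub> ((l J \<cdot>\<^bsub>C\<^esub> r' I) \<otimes>\<^bsub>C\<^esub> Id C X)
          = l' X \<cdot>\<^bsub>C\<^esub> ((l J \<otimes>\<^bsub>C\<^esub> Id C X) \<cdot>\<^bsub>C\<^esub> (r' I \<otimes>\<^bsub>C\<^esub> Id C X))"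
        using U.tensor_comp[OF rI lJ x x] by (simp add: xx)
      also have "\<dots> = l' X \<cdot>\<^bsub>C\<^esub> (l (J \<odot>\<^bsub>C\<^esub> X) \<cdot>\<^bsub>C\<^esub> \<alpha>\<^bsub>C\<^esub> I J X \<cdot>\<^bsub>C\<^esub> (r' I \<otimes>\<^bsub>C\<^esub> Id C X))"
        by (simp add: U.l_tensor[OF J X])
      also have "\<dots> = (l' X \<cdot>\<^bsub>C\<^esub> l (J \<odot>\<^bsub>C\<^esub> X)) \<cdot>\<^bsub>C\<^esub> (\<alpha>\<^bsub>C\<^esub> I J X \<cdot>\<^bsub>C\<^esub> (r' I \<otimes>\<^bsub>C\<^esub> Id C X))"
        by (simp add: U.comp_assoc[OF rx a ljx] U.comp_assoc[OF U.comp_hom[OF rx a] ljx l'x])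
      also have "\<dots> = (l X \<cdot>\<^bsub>C\<^esub> (Id C I \<otimes>\<^bsub>C\<^esub> l' X)) \<cdot>\<^bsub>C\<^esub> (\<alpha>\<^bsub>C\<^esub> I J X \<cdot>\<^bsub>C\<^esub> (r' I \<otimes>\<^bsub>C\<^esub> Id C X))"
        by (simp add: U.l_nat[OF l'x])
      also have "\<dots> = l X \<cdot>\<^bsub>C\<^esub> ((Id C I \<otimes>\<^bsub>C\<^esub> l' X) \<cdot>\<^bsub>C\<^esub> \<alpha>\<^bsub>C\<^esub> I J X \<cdot>\<^bsub>C\<^esub> (r' I \<otimes>\<^bsub>C\<^esub> Id C X))"
        by (simp add: U.comp_assoc[OF rx a il']
            U.comp_assoc[OF U.comp_hom[OF rx a] il' U.l_hom[OF X]])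
      also have "\<dots> = l X"
        by (simp add: V.triangle[OF I X] U.id_right[OF U.l_hom[OF X]])
      finally show ?thesis .
    qed

    show "(Id C X \<otimes>\<^bsub>C\<^esub> (l J \<cdot>\<^bsub>C\<^esub> r' I)) \<cdot>\<^bsub>C\<^esub> r X = r' X"
    proof -
      note XI = U.tensor_obj[OF X I]
      note a = U.assoc_hom[OF X I J] and r'xi = V.r_hom[OF XI]
      note rx = U.r_hom[OF X] and r'x = V.r_hom[OF X]
      note xr' = U.tensor_hom[OF x rI] and xl = U.tensor_hom[OF x lJ]
      note rj = U.tensor_hom[OF rx j]
      have "(Id C X \<otimes>\<^bsub>C\<^esub> (l J \<cdot>\<^bsub>C\<^esub> r' I)) \<cdot>\<^bsub>C\<^esub> r X
          = (Id C X \<otimes>\<^bsub>C\<^esub> l J) \<cdot>\<^bsub>C\<^esub> (Id C X \<otimes>\<^bsub>C\<^esub> r' I) \<cdot>\<^bsub>C\<^esub> r X"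
        using U.tensor_comp[OF x x rI lJ] by (simp add: xx)
      also have "\<dots> = (Id C X \<otimes>\<^bsub>C\<^esub> l J) \<cdot>\<^bsub>C\<^esub> (\<alpha>\<^bsub>C\<^esub> X I J \<cdot>\<^bsub>C\<^esub> r' (X \<odot>\<^bsub>C\<^esub> I)) \<cdot>\<^bsub>C\<^esub> r X"
        by (simp add: V.r_tensor[OF X I])
      also have "\<dots> = ((Id C X \<otimes>\<^bsub>C\<^esub> l J) \<cdot>\<^bsub>C\<^esub> \<alpha>\<^bsub>C\<^esub> X I J) \<cdot>\<^bsub>C\<^esub> (r' (X \<odot>\<^bsub>C\<^esub> I) \<cdot>\<^bsub>C\<^esub> r X)"
        by (simp add: U.comp_assoc[OF r'xi a xl, symmetric]
            U.comp_assoc[OF rx r'xi U.comp_hom[OF a xl]])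
      also have "\<dots> = ((Id C X \<otimes>\<^bsub>C\<^esub> l J) \<cdot>\<^bsub>C\<^esub> \<alpha>\<^bsub>C\<^esub> X I J) \<cdot>\<^bsub>C\<^esub> ((r X \<otimes>\<^bsub>C\<^esub> Id C J) \<cdot>\<^bsub>C\<^esub> r' X)"
        by (simp add: V.r_nat[OF rx])
      also have "\<dots> = ((Id C X \<otimes>\<^bsub>C\<^esub> l J) \<cdot>\<^bsub>C\<^esub> \<alpha>\<^bsub>C\<^esub> X I J \<cdot>\<^bsub>C\<^esub> (r X \<otimes>\<^bsub>C\<^esub> Id C J)) \<cdot>\<^bsub>C\<^esub> r' X"
        by (rule U.comp_assoc[OF r'x rj U.comp_hom[OF a xl], symmetric])
      also have "\<dots> = r' X"
        by (simp add: U.triangle[OF X J] U.id_left[OF r'x])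
      finally show ?thesis .
    qed
  qed
qed

theorem proposition2p2:
  fixes C :: "('o, 'm) skew_cat"
    and I J :: 'o and l r l' r' :: "'o \<Rightarrow> 'm"
  assumes "skew_semimonoidal_category C"
    and "(I, l, r) \<in> Obj (units_cat C)"
    and "(J, l', r') \<in> Obj (units_cat C)"
  shows "\<exists>!f. f \<in> Hom (units_cat C) (I, l, r) (J, l', r')"
proof -
  have "skew_unit C I l r" "skew_unit C J l' r'"
    using assms(2,3) by (simp_all add: units_cat_def)
  then have "skew_unit_morphism C I l r J l' r' (l J \<cdot>\<^bsub>C\<^esub> r' I)"
    by (rule canonical_unit_morphism)
  then show ?thesis
    unfolding units_cat_Hom by (blast dest: skew_unit_morphism.mor_eq)
qed

end
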